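(* Let $N$ be a nonnegative integer-valued random variable and let $X_1,X_2,\ldots$ be a sequence of independent and identically distributed nonnegative random variables with finite mean $\mu=\mathrm{E}[X_1]>0$, all defined on the same probability space. The dependence between $N$ and $\{X_i\}_{i\ge 1}$ is arbitrary. Let $S_0=0$, $S_n=X_1+\cdots+X_n$ for $n\ge 1$, and $S_N=\sum_{i=1}^N X_i$. Suppose that the tail of the distribution of $N$ is of consistent variation, that $\mathrm{E}[X_1^r]<\infty$ for some $r>1$, and that $$x\,\Pr[X_1>x]=o(\Pr[N>x]),\qquad x\to\infty.$$ Then $$\Pr[S_N>x]\sim \Pr[N>x/\mu],\qquad x\to\infty.$$
   Context: For a distribution function $F$, write $\overline F=1-F$. $F$ has a consistently varying tail (its tail is of consistent variation) if $\overline F(x)>0$ for all $x$ and $\lim_{y\uparrow 1}\limsup_{x\to\infty}\overline F(xy)/\overline F(x)=1$. For $N$ this is applied to $F(x)=\Pr[N\le x]$. For positive functions $f,g$ defined in a neighbourhood of infinity, $f(x)\sim g(x)$ means $f(x)/g(x)\to 1$; for $g$ positive, $f(x)=o(g(x))$ means $f(x)/g(x)\to 0$, as $x\to\infty$. *)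

theory Defs
  imports "HOL-Probability.Probability"
begin

(* The limsup of the tail ratio is taken in ereal, since it might a priori be infinite
   and Limsup needs a complete lattice. *)
definition consistently_varying_tail :: "(real \<Rightarrow> real) \<Rightarrow> bool" where
  "consistently_varying_tail F \<longleftrightarrow>
     (\<forall>x. 1 - F x > 0) \<and>
     ((\<lambda>y. Limsup at_top (\<lambda>x. ereal ((1 - F (x * y)) / (1 - F x)))) \<longlongrightarrow> 1) (at_left 1)"

end

theory Submission
  imports Defs "HOL-Real_Asymp.Real_Asymp"
begin

text \<open>
  Write \<open>G x = P(N > x)\<close> and fix \<open>y < 1\<close> close to \<open>1\<close>. Since \<open>S\<^sub>n\<close> is almost surely increasing in \<open>n\<close>,
  \<open>S\<^sub>N > x\<close> forces \<open>N > y x / \<mu>\<close> unless \<open>S\<^sub>n > x\<close> for the deterministic index \<open>n = \<lfloor>y x / \<mu>\<rfloor>\<close>,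
  and conversely \<open>N > x / (y \<mu>)\<close> forces \<open>S\<^sub>N > x\<close> unless \<open>S\<^sub>n \<le> x\<close> for \<open>n = \<lfloor>x / (y \<mu>)\<rfloor>\<close>. This gives
  the claim for any dependence, by consistent variation, as soon as linear deviations of \<open>S\<^sub>n\<close> from
  \<open>n \<mu>\<close> have probability \<open>o(G n)\<close>. Consistent variation bounds \<open>G\<close> from below by a power of \<open>x\<close>.
  Lower deviations are exponentially rare. For upper deviations, truncating the summands at \<open>v n\<close>
  with \<open>v\<close> small makes Chernoff's bound smaller than any prescribed power of \<open>n\<close>, while some summand
  exceeds \<open>v n\<close> with probability at most \<open>n P(X\<^sub>1 > v n) = o(G n)\<close>.
\<close>

section \<open>Growth bounds for consistently varying tails\<close>

text \<open>The form in which consistent variation enters: \<open>e = 1\<close> yields crude growth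
  bounds on the tail, small \<open>e\<close> the final sandwich. For \<open>y\<close> close to 1 the
  limsup is strictly below \<open>1 + e\<close>, hence so is the ratio itself for large
  \<open>x\<close>.\<close>

lemma consistently_varying_tailD:
  assumes "consistently_varying_tail F" and "e > 0"
  obtains y where "0 < y" "y < 1" "\<forall>\<^sub>F x in at_top. 1 - F (x * y) \<le> (1 + e) * (1 - F x)"
proof -
  have pos: "1 - F x > 0" for x
    using assms(1) unfolding consistently_varying_tail_def by blast
  have lim: "((\<lambda>y. Limsup at_top (\<lambda>x. ereal ((1 - F (x * y)) / (1 - F x)))) \<longlongrightarrow> 1) (at_left 1)"
    using assms(1) unfolding consistently_varying_tail_def by blast
  have "\<forall>\<^sub>F y in at_left 1. Limsup at_top (\<lambda>x. ereal ((1 - F (x * y)) / (1 - F x))) < ereal (1 + e)"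
    by (rule order_tendstoD(2)[OF lim]) (use \<open>e > 0\<close> in \<open>simp add: one_ereal_def\<close>)
  moreover have "\<forall>\<^sub>F y in at_left (1::real). y \<in> {0<..<1}"
    by (rule eventually_at_leftI[of 0]) auto
  ultimately have "\<forall>\<^sub>F y in at_left (1::real). y \<in> {0<..<1} \<and>
      Limsup at_top (\<lambda>x. ereal ((1 - F (x * y)) / (1 - F x))) < ereal (1 + e)"
    by eventually_elim auto
  then obtain y where y: "0 < y" "y < 1"
    "Limsup at_top (\<lambda>x. ereal ((1 - F (x * y)) / (1 - F x))) < ereal (1 + e)"
    using eventually_happens[of _ "at_left (1::real)"] by (auto simp: trivial_limit_at_left_real)
  from Limsup_lessD[OF y(3)] have "\<forall>\<^sub>F x in at_top. 1 - F (x * y) \<le> (1 + e) * (1 - F x)"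
    by eventually_elim (use pos in \<open>simp add: divide_simps split: if_splits\<close>)
  with y that show ?thesis by blast
qed

text \<open>Iterating the bound \<open>k\<close> times, until \<open>y ^ k < v\<close>, costs only
  the constant \<open>2 ^ k\<close>. This dominated variation allows the argument of the tail to be
  rescaled inside O and o.\<close>

lemma tail_dominated:
  fixes G :: "real \<Rightarrow> real"
  assumes "antimono G" and y: "0 < y" "y < 1"
    and ev: "\<forall>\<^sub>F x in at_top. G (x * y) \<le> 2 * G x" and v: "v > 0"
  obtains C where "C > 0" "\<forall>\<^sub>F x in at_top. G (v * x) \<le> C * G x"
proof -
  have iter: "\<forall>\<^sub>F x in at_top. G (y ^ k * x) \<le> 2 ^ k * G x" for k
  proof (induction k)
    case (Suc k)
    have "filterlim (\<lambda>x. y ^ k * x) at_top at_top"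
      using y by (intro filterlim_tendsto_pos_mult_at_top[OF tendsto_const]) (auto intro: filterlim_ident)
    from eventually_compose_filterlim[OF ev this] Suc show ?case
      by eventually_elim (simp add: mult_ac)
  qed simp
  obtain k where k: "y ^ k < v"
    using real_arch_pow_inv[OF v y(2)] by blast
  have "\<forall>\<^sub>F x in at_top. G (v * x) \<le> 2 ^ k * G x"
    using iter[of k] eventually_ge_at_top[of 0]
  proof eventually_elim
    case (elim x)
    have "G (v * x) \<le> G (y ^ k * x)"
      by (rule antimonoD[OF \<open>antimono G\<close>]) (use k elim in \<open>simp add: mult_right_mono\<close>)
    with elim show ?case by linarith
  qed
  then show ?thesis by (intro that[of "2 ^ k"]) auto
qed

text \<open>Each multiplication of the argument by \<open>y\<close> at most doubles
  \<open>G\<close>, and it exactly doubles \<open>x powr - p\<close> once \<open>p\<close> is chosen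
  with \<open>y powr - p = 2\<close>. A power bound therefore propagates from a bounded interval to
  infinity.\<close>

lemma tail_ge_powr:
  fixes G :: "real \<Rightarrow> real"
  assumes "antimono G" and pos: "\<And>x. G x > 0" and y: "0 < y" "y < 1"
    and ev: "\<forall>\<^sub>F x in at_top. G (x * y) \<le> 2 * G x"
  obtains c p where "c > 0" "p > 0" "\<forall>\<^sub>F x in at_top. c * x powr - p \<le> G x"
proof -
  obtain x0 where x0: "x0 > 0" "\<And>x. x \<ge> x0 \<Longrightarrow> G (x * y) \<le> 2 * G x"
    using ev unfolding eventually_at_top_linorder
    by (metis max.bounded_iff max.cobounded1 zero_less_one order_less_le_trans)
  define p where "p = ln 2 / - ln y"
  have p: "p > 0" using y by (simp add: p_def divide_pos_neg)
  have yp: "y powr - p = 2"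
    using y by (simp add: powr_def p_def)
  \<comment> \<open>Makes the bound true on the interval from \<open>x0\<close> to
    \<open>x0 / y\<close>, where the power is at most \<open>x0 powr - p\<close> and
    \<open>G\<close> is at least \<open>G (x0 / y)\<close>.\<close>
  define c where "c = G (x0 / y) / x0 powr - p"
  have c: "c > 0" using pos x0 by (simp add: c_def)
  \<comment> \<open>Induction on a number \<open>k\<close> of multiplications by \<open>y\<close>
    that brings \<open>x\<close> down to \<open>x0\<close> or below.\<close>
  have *: "c * x powr - p \<le> G x" if "x0 \<le> x" "x * y ^ k \<le> x0" for x k
    using that
  proof (induction k arbitrary: x)
    case 0
    have "c * x powr - p = G (x0 / y)" using 0 x0 by (simp add: c_def)
    also have "\<dots> \<le> G x"
      by (rule antimonoD[OF \<open>antimono G\<close>]) (use 0 x0 y in \<open>simp add: field_simps mult_left_le\<close>)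
    finally show ?case .
  next
    case (Suc k)
    show ?case
    proof (cases "x * y \<ge> x0")
      case True
      have "c * (x * y) powr - p \<le> G (x * y)"
        using Suc True by (intro Suc.IH) (auto simp: mult_ac)
      also have "\<dots> \<le> 2 * G x" using x0 Suc by auto
      finally show ?thesis
        using yp y Suc.prems x0 by (simp add: powr_mult)
    next
      case False
      have "c * x powr - p \<le> c * x0 powr - p"
        using Suc.prems x0 p c by (intro mult_left_mono powr_mono2') auto
      also have "\<dots> = G (x0 / y)" using x0 by (simp add: c_def)
      also have "\<dots> \<le> G x"
        by (rule antimonoD[OF \<open>antimono G\<close>]) (use False y in \<open>simp add: field_simps\<close>)
      finally show ?thesis .
    qed
  qed
  have "\<forall>\<^sub>F x in at_top. c * x powr - p \<le> G x"
    using eventually_ge_at_top[of x0]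
  proof eventually_elim
    case (elim x)
    obtain k where "y ^ k < x0 / x"
      using real_arch_pow_inv[of "x0 / x" y] y elim x0 by auto
    then have "x * y ^ k \<le> x0" using elim x0 by (simp add: field_simps)
    with * elim show ?case by blast
  qed
  with c p that show ?thesis by blast
qed

section \<open>Exponential inequality with a remainder of order \<open>r\<close>\<close>

text \<open>Replaces the Taylor remainder so that a moment of order \<open>r\<close> suffices: for
  \<open>\<bar>y\<bar> \<le> 1\<close> the quadratic remainder is at most
  \<open>\<bar>y\<bar> powr r\<close> because \<open>r \<le> 2\<close>, and beyond that
  \<open>\<bar>y\<bar>\<close> itself is at most this power because \<open>r > 1\<close>.\<close>

lemma exp_le_one_plus_powr:
  fixes y r :: real
  assumes "1 < r" "r \<le> 2"
  shows "exp y \<le> 1 + y + \<bar>y\<bar> powr r * exp (max 0 y)"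
proof (cases "\<bar>y\<bar> \<le> 1")
  case True
  have "exp y \<le> 1 + y + y\<^sup>2"
  proof (cases "y \<ge> 0")
    case False
    define z where "z = - y"
    have z: "z > 0" using False by (simp add: z_def)
    \<comment> \<open>The product expands to \<open>1 + (z^2 + z^3 + z^4) / 2\<close>; its second
      factor is the quadratic Taylor polynomial below \<open>exp z\<close>.\<close>
    have "1 \<le> (1 - z + z\<^sup>2) * (1 + z + z\<^sup>2 / 2)"
      using z by (simp add: field_simps power2_eq_square)
    also have "\<dots> \<le> (1 - z + z\<^sup>2) * exp z"
    proof (intro mult_left_mono exp_lower_Taylor_quadratic)
      have "1 - z + z\<^sup>2 = (z - 1 / 2)\<^sup>2 + 3 / 4"
        by (simp add: power2_eq_square algebra_simps)
      then show "0 \<le> 1 - z + z\<^sup>2" by simp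
    qed (use z in simp)
    finally show ?thesis
      by (simp add: z_def exp_minus field_simps)
  qed (use True in \<open>simp add: exp_bound\<close>)
  also have "y\<^sup>2 = \<bar>y\<bar> powr 2" by simp
  also have "\<bar>y\<bar> powr 2 \<le> \<bar>y\<bar> powr r"
    using True assms by (intro powr_mono') auto
  also have "\<bar>y\<bar> powr r \<le> \<bar>y\<bar> powr r * exp (max 0 y)"
    by (simp add: mult_le_cancel_left1)
  finally show ?thesis by simp
next
  case False
  have ge: "\<bar>y\<bar> \<le> \<bar>y\<bar> powr r"
    using False assms powr_mono[of 1 r "\<bar>y\<bar>"] by simp
  show ?thesis
  proof (cases "y \<ge> 0")
    case True
    have "(1 - y) * exp y \<le> exp (- y) * exp y"
      using exp_ge_add_one_self[of "- y"] by (intro mult_right_mono) auto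
    then have "exp y \<le> 1 + \<bar>y\<bar> * exp (max 0 y)"
      using True by (simp add: exp_minus field_simps)
    also have "\<dots> \<le> 1 + \<bar>y\<bar> powr r * exp (max 0 y)"
      using ge by simp
    finally show ?thesis using True by simp
  next
    case neg: False
    then have "exp y \<le> 1" "max 0 y = 0" "\<bar>y\<bar> = - y" by simp_all
    with ge show ?thesis by (simp only: exp_zero mult_1_right)
  qed
qed

section \<open>Chernoff bounds and linear deviations of the partial sums\<close>

text \<open>The restriction \<open>r \<le> 2\<close> matches \<open>exp_le_one_plus_powr\<close>;
  larger exponents are reduced to it by \<open>min r 2\<close>.\<close>

locale iid_nonneg_sequence = prob_space M for M :: "'a measure" +
  fixes X :: "nat \<Rightarrow> 'a \<Rightarrow> real" and r :: real
  assumes indep: "indep_vars (\<lambda>_. borel) X {1..}"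
    and ident: "\<And>i. i \<ge> 1 \<Longrightarrow> distr M borel (X i) = distr M borel (X 1)"
    and nonneg: "\<And>i. i \<ge> 1 \<Longrightarrow> AE \<omega> in M. X i \<omega> \<ge> 0"
    and integrable_X1: "integrable M (X 1)"
    and moment_X1: "integrable M (\<lambda>\<omega>. X 1 \<omega> powr r)"
    and r_bounds: "1 < r" "r \<le> 2"
begin

lemma measurable_X: "i \<ge> 1 \<Longrightarrow> X i \<in> borel_measurable M"
  using indep unfolding indep_vars_def by auto

lemma measurable_partial_sum: "(\<lambda>\<omega>. \<Sum>i=1..n. X i \<omega>) \<in> borel_measurable M"
  by (intro borel_measurable_sum measurable_X) auto

lemma AE_nonneg: "AE \<omega> in M. \<forall>i\<ge>1. X i \<omega> \<ge> 0"
  using nonneg by (simp add: AE_all_countable)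

lemma prob_tail_eq:
  assumes "i \<ge> 1"
  shows "prob {\<omega> \<in> space M. X i \<omega> > c} = prob {\<omega> \<in> space M. X 1 \<omega> > c}"
proof -
  have *: "prob {\<omega> \<in> space M. X j \<omega> > c} = measure (distr M borel (X j)) {c<..}" if "j \<ge> 1" for j
    using that measurable_X by (subst measure_distr) (auto intro!: arg_cong[of _ _ prob])
  show ?thesis
    using assms ident[OF assms] by (simp add: * del: One_nat_def)
qed

text \<open>Markov's inequality for the exponential of the sum, whose expectation factorizes by
  independence. A general \<open>f\<close> covers both the tilt \<open>- s * x\<close> and the
  truncated summand \<open>s * min x c\<close>.\<close>

lemma chernoff_bound:
  assumes f[measurable]: "f \<in> borel_measurable borel"
    and int: "integrable M (\<lambda>\<omega>. exp (f (X 1 \<omega>)))"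
    and m: "expectation (\<lambda>\<omega>. exp (f (X 1 \<omega>))) \<le> m"
  shows "prob {\<omega> \<in> space M. (\<Sum>i=1..n. f (X i \<omega>)) \<ge> t} \<le> exp (- t) * m ^ n"
proof -
  have ind: "indep_vars (\<lambda>_. borel) (\<lambda>i \<omega>. exp (f (X i \<omega>))) {1..n}"
    by (rule indep_vars_compose2[OF indep_vars_subset[OF indep], of _ "\<lambda>_ x. exp (f x)"]) auto
  have int_i: "integrable M (\<lambda>\<omega>. exp (f (X i \<omega>)))"
    and exp_i: "expectation (\<lambda>\<omega>. exp (f (X i \<omega>))) = expectation (\<lambda>\<omega>. exp (f (X 1 \<omega>)))"
    if "i \<ge> 1" for i
  proof -
    have eq: "integrable (distr M borel (X j)) (\<lambda>x. exp (f x)) = integrable M (\<lambda>\<omega>. exp (f (X j \<omega>)))"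
      "integral\<^sup>L (distr M borel (X j)) (\<lambda>x. exp (f x)) = expectation (\<lambda>\<omega>. exp (f (X j \<omega>)))"
      if "j \<ge> 1" for j
      using measurable_X[OF that] by (simp_all add: integrable_distr_eq integral_distr)
    show "integrable M (\<lambda>\<omega>. exp (f (X i \<omega>)))"
      "expectation (\<lambda>\<omega>. exp (f (X i \<omega>))) = expectation (\<lambda>\<omega>. exp (f (X 1 \<omega>)))"
      using int eq[OF that] eq[of 1] ident[OF that] by auto
  qed
  have prod: "exp (\<Sum>i=1..n. f (X i \<omega>)) = (\<Prod>i=1..n. exp (f (X i \<omega>)))" for \<omega>
    by (simp add: exp_sum)
  have "prob {\<omega> \<in> space M. exp (\<Sum>i=1..n. f (X i \<omega>)) \<ge> exp t} \<le>
      expectation (\<lambda>\<omega>. exp (\<Sum>i=1..n. f (X i \<omega>))) / exp t"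
    unfolding prod using int_i
    by (intro integral_Markov_inequality_measure[where A = "space M"] indep_vars_integrable[OF _ ind])
      (auto intro!: prod_nonneg)
  also have "expectation (\<lambda>\<omega>. exp (\<Sum>i=1..n. f (X i \<omega>))) =
      (\<Prod>i=1..n. expectation (\<lambda>\<omega>. exp (f (X i \<omega>))))"
    unfolding prod using int_i by (intro indep_vars_lebesgue_integral[OF _ ind]) auto
  also have "\<dots> = (\<Prod>i=1..n. expectation (\<lambda>\<omega>. exp (f (X 1 \<omega>))))"
    by (intro prod.cong refl exp_i) auto
  also have "\<dots> = expectation (\<lambda>\<omega>. exp (f (X 1 \<omega>))) ^ n"
    by simp
  also have "\<dots> / exp t \<le> m ^ n / exp t"
    using m by (intro divide_right_mono power_mono) auto
  finally show ?thesis by (simp add: exp_minus field_simps)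
qed

text \<open>Integrates \<open>exp_le_one_plus_powr\<close> at \<open>f (X 1 \<omega>)\<close>,
  bounding the power by \<open>(s * x) powr r\<close> and the exponential factor by
  \<open>exp c\<close>, and closes with \<open>1 + u \<le> exp u\<close>.\<close>

lemma exp_moment_bound:
  assumes f[measurable]: "f \<in> borel_measurable borel"
    and s: "s \<ge> 0" and c: "c \<ge> 0"
    and abs: "\<And>x. x \<ge> 0 \<Longrightarrow> \<bar>f x\<bar> \<le> s * x" and le: "\<And>x. x \<ge> 0 \<Longrightarrow> f x \<le> c"
    and m: "expectation (\<lambda>\<omega>. f (X 1 \<omega>)) \<le> m"
  shows "integrable M (\<lambda>\<omega>. exp (f (X 1 \<omega>)))"
    and "expectation (\<lambda>\<omega>. exp (f (X 1 \<omega>))) \<le>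
           exp (m + s powr r * expectation (\<lambda>\<omega>. X 1 \<omega> powr r) * exp c)"
proof -
  have [measurable]: "X (Suc 0) \<in> borel_measurable M" by (rule measurable_X) simp
  note nn = nonneg[of 1, simplified]
  show int: "integrable M (\<lambda>\<omega>. exp (f (X 1 \<omega>)))"
    by (rule integrable_const_bound[where B = "exp c"]) (use nn le in auto)
  have intf: "integrable M (\<lambda>\<omega>. f (X 1 \<omega>))"
    by (rule Bochner_Integration.integrable_bound[OF integrable_mult_right[OF integrable_X1, of s]])
      (use nn abs s in auto)
  have "expectation (\<lambda>\<omega>. exp (f (X 1 \<omega>))) \<le>
      expectation (\<lambda>\<omega>. 1 + f (X 1 \<omega>) + s powr r * X 1 \<omega> powr r * exp c)"
  proof (rule integral_mono_AE[OF int])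
    show "integrable M (\<lambda>\<omega>. 1 + f (X 1 \<omega>) + s powr r * X 1 \<omega> powr r * exp c)"
      using intf moment_X1 by simp
    show "AE \<omega> in M. exp (f (X 1 \<omega>)) \<le> 1 + f (X 1 \<omega>) + s powr r * X 1 \<omega> powr r * exp c"
      using nn
    proof eventually_elim
      case (elim \<omega>)
      then have x: "X 1 \<omega> \<ge> 0" by simp
      have "exp (f (X 1 \<omega>)) \<le> 1 + f (X 1 \<omega>) + \<bar>f (X 1 \<omega>)\<bar> powr r * exp (max 0 (f (X 1 \<omega>)))"
        using r_bounds by (rule exp_le_one_plus_powr)
      also have "\<dots> \<le> 1 + f (X 1 \<omega>) + (s * X 1 \<omega>) powr r * exp c"
        using abs[OF x] le[OF x] c r_bounds
        by (intro add_left_mono mult_mono powr_mono2) auto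
      finally show ?case using s x by (simp add: powr_mult)
    qed
  qed
  also have "\<dots> = 1 + (expectation (\<lambda>\<omega>. f (X 1 \<omega>)) +
      s powr r * expectation (\<lambda>\<omega>. X 1 \<omega> powr r) * exp c)"
    using intf moment_X1 by (simp add: prob_space del: One_nat_def)
  also have "\<dots> \<le> 1 + (m + s powr r * expectation (\<lambda>\<omega>. X 1 \<omega> powr r) * exp c)"
    using m by simp
  also have "\<dots> \<le> exp (m + s powr r * expectation (\<lambda>\<omega>. X 1 \<omega> powr r) * exp c)"
    by (rule exp_ge_add_one_self)
  finally show "expectation (\<lambda>\<omega>. exp (f (X 1 \<omega>))) \<le>
      exp (m + s powr r * expectation (\<lambda>\<omega>. X 1 \<omega> powr r) * exp c)" .
qed

lemma lower_deviation:
  assumes \<delta>: "\<delta> > 0"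
  obtains c where "c > 0" "\<And>n. prob {\<omega> \<in> space M. (\<Sum>i=1..n. X i \<omega>) \<le> real n * (expectation (X 1) - \<delta>)} \<le>
    exp (- c * real n)"
proof -
  define K where "K = expectation (\<lambda>\<omega>. X 1 \<omega> powr r)"
  \<comment> \<open>As \<open>r > 1\<close>, the error \<open>s powr r * K\<close> is of smaller
    order than the gain \<open>s * \<delta>\<close>; \<open>s\<close> is taken so small that half of
    the gain survives.\<close>
  have "((\<lambda>s. s powr (r - 1) * K) \<longlongrightarrow> 0) (at_right 0)"
    using r_bounds by real_asymp
  from order_tendstoD(2)[OF this, of "\<delta> / 2"] eventually_at_right_less[of "0::real"]
  have "\<forall>\<^sub>F s in at_right 0. s > 0 \<and> s powr (r - 1) * K < \<delta> / 2"
    using \<delta> by (auto elim: eventually_elim2)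
  then obtain s where s: "s > 0" "s powr (r - 1) * K < \<delta> / 2"
    using eventually_happens[of _ "at_right (0::real)"] by (auto simp: trivial_limit_at_right_real)
  define \<mu> where "\<mu> = expectation (X 1)"
  have sr: "s powr r * K \<le> s * \<delta> / 2"
    using s mult_left_mono[of "s powr (r - 1) * K" "\<delta> / 2" s] by (simp add: powr_diff)
  have "prob {\<omega> \<in> space M. (\<Sum>i=1..n. X i \<omega>) \<le> real n * (\<mu> - \<delta>)} \<le> exp (- (s * \<delta> / 2) * real n)" for n
  proof -
    have b: "integrable M (\<lambda>\<omega>. exp (- s * X 1 \<omega>))"
      "expectation (\<lambda>\<omega>. exp (- s * X 1 \<omega>)) \<le> exp (- s * \<mu> + s powr r * K * exp 0)"
      unfolding K_def
      by (rule exp_moment_bound[where f = "\<lambda>x. - s * x" and c = 0]; use s in \<open>auto simp: \<mu>_def\<close>)+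
    have "{\<omega> \<in> space M. (\<Sum>i=1..n. X i \<omega>) \<le> real n * (\<mu> - \<delta>)} =
        {\<omega> \<in> space M. (\<Sum>i=1..n. - s * X i \<omega>) \<ge> - s * (real n * (\<mu> - \<delta>))}"
      using s by (simp add: sum_distrib_left[symmetric] sum_negf)
    also have "prob \<dots> \<le> exp (s * (real n * (\<mu> - \<delta>))) * exp (- s * \<mu> + s powr r * K) ^ n"
      using chernoff_bound[where f = "\<lambda>x. - s * x" and t = "- s * (real n * (\<mu> - \<delta>))" and n = n, OF _ b]
      by simp
    also have "\<dots> = exp (real n * (- s * \<delta> + s powr r * K))"
      by (simp add: exp_add[symmetric] exp_of_nat_mult[symmetric] algebra_simps)
    also have "\<dots> \<le> exp (- (s * \<delta> / 2) * real n)"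
      using sr mult_left_mono[of "- s * \<delta> + s powr r * K" "- (s * \<delta> / 2)" "real n"] by (simp add: mult_ac)
    finally show ?thesis .
  qed
  with that[of "s * \<delta> / 2"] s \<delta> show ?thesis unfolding \<mu>_def by auto
qed

text \<open>The power \<open>p\<close> is arbitrary, at the price of a smaller truncation constant
  \<open>v\<close>, because the power bounding the tail of \<open>N\<close> from below is not under
  control.\<close>

lemma upper_deviation:
  assumes \<delta>: "\<delta> > 0" and p: "p > 0"
  obtains v where "v > 0"
    "\<forall>\<^sub>F n in sequentially. prob {\<omega> \<in> space M. (\<Sum>i=1..n. X i \<omega>) \<ge> real n * (expectation (X 1) + \<delta>)} \<le>
       real n * prob {\<omega> \<in> space M. X 1 \<omega> > v * real n} + exp 1 * real n powr - p"
proof -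
  define K where "K = expectation (\<lambda>\<omega>. X 1 \<omega> powr r)"
  define \<mu> where "\<mu> = expectation (X 1)"
  \<comment> \<open>With exponent \<open>s = a ln n / n\<close>, Chernoff's bound gains the factor \<open>exp (- s \<delta> n) = n powr - p\<close>; the
    choice of \<open>v\<close> gives \<open>exp (s v n) = n powr ((r - 1) / 2)\<close>, so that the error term
    \<open>n s powr r exp (s v n)\<close> tends to 0.\<close>
  define a where "a = p / \<delta>"
  define v where "v = (r - 1) / (2 * a)"
  have a: "a > 0" and v: "v > 0" using \<delta> p r_bounds by (auto simp: a_def v_def)
  define q where "q = (r - 1) / 2"
  have q: "q > 0" using r_bounds by (simp add: q_def)
  have "(\<lambda>n. a powr r * K * (ln (real n) powr r * real n powr - q)) \<longlonglongrightarrow> 0"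
    by (rule tendsto_mult_right_zero) (use q r_bounds in real_asymp)
  moreover have "\<forall>\<^sub>F n in sequentially. a powr r * K * (ln (real n) powr r * real n powr - q) =
      real n * ((a * ln (real n) / real n) powr r * K * real n powr q)"
    using eventually_gt_at_top[of 1]
  proof eventually_elim
    case (elim n)
    \<comment> \<open>Since \<open>q = (r - 1) / 2\<close>, the exponents satisfy
      \<open>- q = 1 + q - r\<close>.\<close>
    have "real n powr - q = real n powr (1 + q - r)"
      unfolding q_def by (rule arg_cong[where f = "(powr) (real n)"]) (simp add: field_simps)
    also have "\<dots> = real n * real n powr q / real n powr r"
      using elim by (simp add: powr_diff powr_add)
    finally show ?case
      using elim a by (simp add: powr_mult powr_divide)
  qed
  ultimately have "(\<lambda>n. real n * ((a * ln (real n) / real n) powr r * K * real n powr q)) \<longlonglongrightarrow> 0"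
    by (rule Lim_transform_eventually)
  then have small: "\<forall>\<^sub>F n in sequentially. real n * ((a * ln (real n) / real n) powr r * K * real n powr q) < 1"
    by (rule order_tendstoD) simp
  have "\<forall>\<^sub>F n in sequentially. prob {\<omega> \<in> space M. (\<Sum>i=1..n. X i \<omega>) \<ge> real n * (\<mu> + \<delta>)} \<le>
       real n * prob {\<omega> \<in> space M. X 1 \<omega> > v * real n} + exp 1 * real n powr - p"
    using small eventually_gt_at_top[of 1]
  proof eventually_elim
    case (elim n)
    define s where "s = a * ln (real n) / real n"
    define c where "c = v * real n"
    define f where "f x = s * min x c" for x
    have s: "s > 0" and c: "c > 0" using elim a v by (auto simp: s_def c_def)
    have sc: "exp (s * c) = real n powr q"
      using elim a by (simp add: s_def c_def v_def q_def powr_def)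
    have f[measurable]: "f \<in> borel_measurable borel"
      unfolding f_def by measurable
    have [measurable]: "X i \<in> borel_measurable M" if "i \<in> {1..n}" for i
      using that by (intro measurable_X) auto
    have [measurable]: "X (Suc 0) \<in> borel_measurable M"
      using measurable_X[of 1] by simp
    have int: "integrable M (\<lambda>\<omega>. min (X 1 \<omega>) c)"
      by (intro integrable_min integrable_X1) auto
    \<comment> \<open>Truncation only lowers the mean, so centring at \<open>\<mu>\<close> remains
      valid.\<close>
    have "expectation (\<lambda>\<omega>. min (X 1 \<omega>) c) \<le> \<mu>"
      unfolding \<mu>_def by (intro integral_mono int integrable_X1) auto
    then have m: "expectation (\<lambda>\<omega>. f (X 1 \<omega>)) \<le> s * \<mu>"
      using s by (simp add: f_def)
    have b: "integrable M (\<lambda>\<omega>. exp (f (X 1 \<omega>)))"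
      "expectation (\<lambda>\<omega>. exp (f (X 1 \<omega>))) \<le> exp (s * \<mu> + s powr r * K * exp (s * c))"
      unfolding K_def
      by (rule exp_moment_bound[where f = f and s = s and c = "s * c"];
          use s c m in \<open>auto simp: f_def abs_mult\<close>)+
    define E1 where "E1 = {\<omega> \<in> space M. (\<Sum>i=1..n. f (X i \<omega>)) \<ge> s * (real n * (\<mu> + \<delta>))}"
    define E2 where "E2 i = {\<omega> \<in> space M. X i \<omega> > c}" for i
    have E[measurable]: "E1 \<in> events" "\<And>i. i \<in> {1..n} \<Longrightarrow> E2 i \<in> events"
      unfolding E1_def E2_def by measurable
    \<comment> \<open>Outside all \<open>E2 i\<close> no summand is truncated, so the sum of the
      \<open>f (X i \<omega>)\<close> is \<open>s\<close> times the original sum.\<close>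
    have sub: "{\<omega> \<in> space M. (\<Sum>i=1..n. X i \<omega>) \<ge> real n * (\<mu> + \<delta>)} \<subseteq> E1 \<union> (\<Union>i\<in>{1..n}. E2 i)"
    proof (rule subsetI)
      fix \<omega> assume \<omega>: "\<omega> \<in> {\<omega> \<in> space M. (\<Sum>i=1..n. X i \<omega>) \<ge> real n * (\<mu> + \<delta>)}"
      show "\<omega> \<in> E1 \<union> (\<Union>i\<in>{1..n}. E2 i)"
      proof (cases "\<exists>i\<in>{1..n}. X i \<omega> > c")
        case False
        then have "(\<Sum>i=1..n. f (X i \<omega>)) = s * (\<Sum>i=1..n. X i \<omega>)"
          unfolding f_def sum_distrib_left by (intro sum.cong) (auto simp: min_def not_less)
        then show ?thesis using \<omega> s by (auto simp: E1_def)
      qed (use \<omega> in \<open>auto simp: E2_def\<close>)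
    qed
    have "prob {\<omega> \<in> space M. (\<Sum>i=1..n. X i \<omega>) \<ge> real n * (\<mu> + \<delta>)} \<le> prob (E1 \<union> (\<Union>i\<in>{1..n}. E2 i))"
      using sub E by (intro finite_measure_mono) auto
    also have "\<dots> \<le> prob E1 + prob (\<Union>i\<in>{1..n}. E2 i)"
      using E by (intro measure_Un_le) auto
    also have "prob (\<Union>i\<in>{1..n}. E2 i) \<le> (\<Sum>i\<in>{1..n}. prob (E2 i))"
      using E by (intro finite_measure_subadditive_finite) auto
    also have "\<dots> = (\<Sum>i\<in>{1..n}. prob {\<omega> \<in> space M. X 1 \<omega> > v * real n})"
      unfolding E2_def c_def by (intro sum.cong refl prob_tail_eq) auto
    also have "\<dots> = real n * prob {\<omega> \<in> space M. X 1 \<omega> > v * real n}"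
      by simp
    also have "prob E1 \<le> exp (- (s * (real n * (\<mu> + \<delta>)))) * exp (s * \<mu> + s powr r * K * exp (s * c)) ^ n"
      unfolding E1_def by (rule chernoff_bound[OF f b])
    also have "\<dots> = exp (- (s * \<delta> * real n) + real n * (s powr r * K * exp (s * c)))"
      by (simp add: exp_add[symmetric] exp_of_nat_mult[symmetric] algebra_simps)
    \<comment> \<open>The accumulated moment error is below 1 by \<open>small\<close>, which is the
      source of the factor \<open>exp 1\<close>.\<close>
    also have "\<dots> \<le> exp (- (s * \<delta> * real n) + 1)"
      unfolding sc unfolding s_def using elim by simp
    also have "s * \<delta> * real n = p * ln (real n)"
      using elim \<delta> by (simp add: s_def a_def)
    also have "exp (- (p * ln (real n)) + 1) = exp 1 * real n powr - p"
      using elim by (simp add: powr_def flip: exp_add)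
    finally show ?case by simp
  qed
  with that v show ?thesis unfolding \<mu>_def by blast
qed

text \<open>The tail \<open>G\<close> dominates some power of \<open>n\<close>, so the exponential
  and power terms are negligible; the single-big-summand term is controlled by
  \<open>small\<close>.\<close>

lemma deviations_negligible:
  fixes G :: "real \<Rightarrow> real"
  assumes G: "antimono G" "\<And>x. G x > 0" and y: "0 < y" "y < 1"
    and ev: "\<forall>\<^sub>F x in at_top. G (x * y) \<le> 2 * G x"
    and small: "(\<lambda>x. x * prob {\<omega> \<in> space M. X 1 \<omega> > x}) \<in> o[at_top](G)" and \<delta>: "\<delta> > 0"
  shows "(\<lambda>n. prob {\<omega> \<in> space M. (\<Sum>i=1..n. X i \<omega>) \<ge> real n * (expectation (X 1) + \<delta>)})
           \<in> o(\<lambda>n. G (real n))"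
    and "(\<lambda>n. prob {\<omega> \<in> space M. (\<Sum>i=1..n. X i \<omega>) \<le> real n * (expectation (X 1) - \<delta>)})
           \<in> o(\<lambda>n. G (real n))"
proof -
  obtain c p where cp: "c > 0" "p > 0" "\<forall>\<^sub>F x in at_top. c * x powr - p \<le> G x"
    using tail_ge_powr[OF G y ev] .
  have powr_G: "(\<lambda>n. real n powr - p) \<in> O(\<lambda>n. G (real n))"
  proof (rule bigoI)
    show "\<forall>\<^sub>F n in sequentially. norm (real n powr - p) \<le> (1 / c) * norm (G (real n))"
      using eventually_compose_filterlim[OF cp(3) filterlim_real_sequentially]
      by eventually_elim (use cp(1) G(2)[THEN less_imp_le] in \<open>simp add: field_simps\<close>)
  qed
  show "(\<lambda>n. prob {\<omega> \<in> space M. (\<Sum>i=1..n. X i \<omega>) \<ge> real n * (expectation (X 1) + \<delta>)})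
           \<in> o(\<lambda>n. G (real n))"
  proof -
    obtain v where v: "v > 0" and dev: "\<forall>\<^sub>F n in sequentially.
        prob {\<omega> \<in> space M. (\<Sum>i=1..n. X i \<omega>) \<ge> real n * (expectation (X 1) + \<delta>)} \<le>
        real n * prob {\<omega> \<in> space M. X 1 \<omega> > v * real n} + exp 1 * real n powr - (p + 1)"
      using upper_deviation[OF \<delta>, of "p + 1"] cp(2) by auto
    obtain C where C: "C > 0" "\<forall>\<^sub>F x in at_top. G (v * x) \<le> C * G x"
      using tail_dominated[OF G(1) y ev v] .
    have lim: "filterlim (\<lambda>n. v * real n) at_top sequentially"
      using v by real_asymp
    \<comment> \<open>The hypothesis is used at \<open>v * real n\<close>; dominated variation then
      returns from \<open>G (v * real n)\<close> to \<open>G (real n)\<close>.\<close>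
    have "(\<lambda>n. v * real n * prob {\<omega> \<in> space M. X 1 \<omega> > v * real n}) \<in> o(\<lambda>n. G (v * real n))"
      by (rule landau_o.small.compose[OF small lim])
    also have "(\<lambda>n. G (v * real n)) \<in> O(\<lambda>n. G (real n))"
      by (rule bigoI[of _ C], use eventually_compose_filterlim[OF C(2) filterlim_real_sequentially] in eventually_elim)
        (use G(2)[THEN less_imp_le] in simp)
    finally have 1: "(\<lambda>n. real n * prob {\<omega> \<in> space M. X 1 \<omega> > v * real n}) \<in> o(\<lambda>n. G (real n))"
      using v by (simp add: mult.assoc)
    have "(\<lambda>n. exp 1 * real n powr - (p + 1)) \<in> o(\<lambda>n. real n powr - p)"
      by real_asymp
    also note powr_G
    finally have 2: "(\<lambda>n. exp 1 * real n powr - (p + 1)) \<in> o(\<lambda>n. G (real n))" .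
    have "(\<lambda>n. prob {\<omega> \<in> space M. (\<Sum>i=1..n. X i \<omega>) \<ge> real n * (expectation (X 1) + \<delta>)}) \<in>
        O(\<lambda>n. real n * prob {\<omega> \<in> space M. X 1 \<omega> > v * real n} + exp 1 * real n powr - (p + 1))"
      by (rule bigoI[of _ 1], use dev in eventually_elim) (simp add: abs_of_nonneg)
    also note sum_in_smallo(1)[OF 1 2]
    finally show ?thesis .
  qed
  show "(\<lambda>n. prob {\<omega> \<in> space M. (\<Sum>i=1..n. X i \<omega>) \<le> real n * (expectation (X 1) - \<delta>)})
           \<in> o(\<lambda>n. G (real n))"
  proof -
    obtain b where b: "b > 0" "\<And>n. prob {\<omega> \<in> space M. (\<Sum>i=1..n. X i \<omega>) \<le> real n * (expectation (X 1) - \<delta>)} \<le>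
        exp (- b * real n)"
      using lower_deviation[OF \<delta>] by blast
    have "(\<lambda>n. prob {\<omega> \<in> space M. (\<Sum>i=1..n. X i \<omega>) \<le> real n * (expectation (X 1) - \<delta>)}) \<in>
        O(\<lambda>n. exp (- b * real n))"
      by (rule bigoI[of _ 1]) (use b(2) in simp)
    also have "(\<lambda>n. exp (- b * real n)) \<in> o(\<lambda>n. real n powr - p)"
      using b(1) by real_asymp
    also note powr_G
    finally show ?thesis .
  qed
qed

section \<open>Comparison of the random sum with sums of deterministic length\<close>

lemma measurable_random_sum:
  assumes [measurable]: "N \<in> measurable M (count_space UNIV)"
  shows "(\<lambda>\<omega>. \<Sum>i=1..N \<omega>. X i \<omega>) \<in> borel_measurable M"
  by (rule measurable_compose_countable[OF measurable_partial_sum assms])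

text \<open>If \<open>N \<omega> \<le> t\<close>, then \<open>N \<omega> \<le> n\<close> and the
  random sum is almost surely at most the sum of length \<open>n\<close>. Only a union bound
  follows, so the joint law of \<open>N\<close> and \<open>X\<close> does not enter.\<close>

lemma random_sum_tail_le:
  assumes N[measurable]: "N \<in> measurable M (count_space UNIV)" and n: "n = nat \<lfloor>t\<rfloor>"
  shows "prob {\<omega> \<in> space M. (\<Sum>i=1..N \<omega>. X i \<omega>) > x} \<le>
    prob {\<omega> \<in> space M. real (N \<omega>) > t} + prob {\<omega> \<in> space M. (\<Sum>i=1..n. X i \<omega>) \<ge> x}"
proof -
  note [measurable] = measurable_random_sum[OF N] measurable_partial_sum
  have "prob {\<omega> \<in> space M. (\<Sum>i=1..N \<omega>. X i \<omega>) > x} \<le>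
      prob ({\<omega> \<in> space M. real (N \<omega>) > t} \<union> {\<omega> \<in> space M. (\<Sum>i=1..n. X i \<omega>) \<ge> x})"
  proof (rule finite_measure_mono_AE)
    show "AE \<omega> in M. \<omega> \<in> {\<omega> \<in> space M. (\<Sum>i=1..N \<omega>. X i \<omega>) > x} \<longrightarrow>
        \<omega> \<in> {\<omega> \<in> space M. real (N \<omega>) > t} \<union> {\<omega> \<in> space M. (\<Sum>i=1..n. X i \<omega>) \<ge> x}"
      using AE_nonneg
    proof eventually_elim
      case (elim \<omega>)
      have "(\<Sum>i=1..N \<omega>. X i \<omega>) \<le> (\<Sum>i=1..n. X i \<omega>)" if "real (N \<omega>) \<le> t"
        using that elim n by (intro sum_mono2) (auto simp: le_nat_floor intro: order_trans)
      then show ?case by force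
    qed
  qed measurable
  also have "\<dots> \<le> prob {\<omega> \<in> space M. real (N \<omega>) > t} + prob {\<omega> \<in> space M. (\<Sum>i=1..n. X i \<omega>) \<ge> x}"
    by (rule measure_Un_le) measurable
  finally show ?thesis .
qed

text \<open>The mirror image: \<open>N \<omega> > t\<close> gives \<open>n \<le> N \<omega>\<close>,
  including for negative \<open>t\<close>, where \<open>n = 0\<close>.\<close>

lemma random_sum_tail_ge:
  assumes N[measurable]: "N \<in> measurable M (count_space UNIV)" and n: "n = nat \<lfloor>t\<rfloor>"
  shows "prob {\<omega> \<in> space M. real (N \<omega>) > t} \<le>
    prob {\<omega> \<in> space M. (\<Sum>i=1..N \<omega>. X i \<omega>) > x} + prob {\<omega> \<in> space M. (\<Sum>i=1..n. X i \<omega>) \<le> x}"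
proof -
  note [measurable] = measurable_random_sum[OF N] measurable_partial_sum
  have "prob {\<omega> \<in> space M. real (N \<omega>) > t} \<le>
      prob ({\<omega> \<in> space M. (\<Sum>i=1..N \<omega>. X i \<omega>) > x} \<union> {\<omega> \<in> space M. (\<Sum>i=1..n. X i \<omega>) \<le> x})"
  proof (rule finite_measure_mono_AE)
    show "AE \<omega> in M. \<omega> \<in> {\<omega> \<in> space M. real (N \<omega>) > t} \<longrightarrow>
        \<omega> \<in> {\<omega> \<in> space M. (\<Sum>i=1..N \<omega>. X i \<omega>) > x} \<union> {\<omega> \<in> space M. (\<Sum>i=1..n. X i \<omega>) \<le> x}"
      using AE_nonneg
    proof eventually_elim
      case (elim \<omega>)
      have "(\<Sum>i=1..n. X i \<omega>) \<le> (\<Sum>i=1..N \<omega>. X i \<omega>)" if "real (N \<omega>) > t"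
      proof -
        have "n \<le> N \<omega>" using that n by linarith
        then show ?thesis using elim by (intro sum_mono2) auto
      qed
      then show ?case by force
    qed
  qed measurable
  also have "\<dots> \<le> prob {\<omega> \<in> space M. (\<Sum>i=1..N \<omega>. X i \<omega>) > x} + prob {\<omega> \<in> space M. (\<Sum>i=1..n. X i \<omega>) \<le> x}"
    by (rule measure_Un_le) measurable
  finally show ?thesis .
qed

end

section \<open>Asymptotic equivalence of the two tails\<close>

theorem theorem3p1:
  fixes M :: "'a measure" and N :: "'a \<Rightarrow> nat" and X :: "nat \<Rightarrow> 'a \<Rightarrow> real"
    and \<mu> r :: real
  assumes "prob_space M"
    and "N \<in> measurable M (count_space UNIV)"
    and "prob_space.indep_vars M (\<lambda>_. borel) X {1..}"
    and "\<And>i. i \<ge> 1 \<Longrightarrow> distr M borel (X i) = distr M borel (X 1)"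
    and "\<And>i. i \<ge> 1 \<Longrightarrow> AE \<omega> in M. X i \<omega> \<ge> 0"
    and "integrable M (X 1)"
    and "\<mu> = integral\<^sup>L M (X 1)"
    and "\<mu> > 0"
    and "consistently_varying_tail (cdf (distr M borel (\<lambda>\<omega>. real (N \<omega>))))"
    and "r > 1"
    and "integrable M (\<lambda>\<omega>. X 1 \<omega> powr r)"
    and "(\<lambda>x. x * measure M {\<omega> \<in> space M. X 1 \<omega> > x})
           \<in> o[at_top](\<lambda>x. measure M {\<omega> \<in> space M. real (N \<omega>) > x})"
  shows "(\<lambda>x. measure M {\<omega> \<in> space M. (\<Sum>i=1..N \<omega>. X i \<omega>) > x})
           \<sim>[at_top] (\<lambda>x. measure M {\<omega> \<in> space M. real (N \<omega>) > x / \<mu>})"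
proof -
  interpret prob_space M by fact
  note [measurable] = assms(2)
  have "X 1 \<in> borel_measurable M"
    using assms(6) by (rule borel_measurable_integrable)
  then have [measurable]: "X (Suc 0) \<in> borel_measurable M" by simp
  have moment: "integrable M (\<lambda>\<omega>. X 1 \<omega> powr min r 2)"
  proof (rule Bochner_Integration.integrable_bound)
    show "integrable M (\<lambda>\<omega>. 1 + X 1 \<omega> powr r)"
      using assms(11) by simp
    show "AE \<omega> in M. norm (X 1 \<omega> powr min r 2) \<le> norm (1 + X 1 \<omega> powr r)"
      using assms(5)[of 1, OF order_refl]
    proof eventually_elim
      case (elim \<omega>)
      have "X 1 \<omega> powr min r 2 \<le> 1 + X 1 \<omega> powr r"
      proof (cases "X 1 \<omega> \<le> 1")
        case True
        then have "X 1 \<omega> powr min r 2 \<le> 1 powr min r 2"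
          using elim \<open>r > 1\<close> by (intro powr_mono2) auto
        then show ?thesis by (simp add: add_increasing2)
      next
        case False
        then have "X 1 \<omega> powr min r 2 \<le> X 1 \<omega> powr r"
          by (intro powr_mono) auto
        then show ?thesis by simp
      qed
      then show ?case by simp
    qed
  qed simp
  interpret iid_nonneg_sequence M X "min r 2"
    by unfold_locales (fact assms moment | use assms(10) in simp)+
  define G where "G x = prob {\<omega> \<in> space M. real (N \<omega>) > x}" for x
  have cdf_G: "1 - cdf (distr M borel (\<lambda>\<omega>. real (N \<omega>))) x = G x" for x
  proof -
    have "cdf (distr M borel (\<lambda>\<omega>. real (N \<omega>))) x = prob {\<omega> \<in> space M. \<not> real (N \<omega>) > x}"
      unfolding cdf_def by (subst measure_distr) (auto intro!: arg_cong[of _ _ prob])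
    then show ?thesis by (subst (asm) prob_neg) (auto simp: G_def)
  qed
  have G_pos: "G x > 0" for x
    using assms(9) unfolding consistently_varying_tail_def cdf_G by blast
  have G_anti: "antimono G"
    unfolding G_def by (intro antimonoI finite_measure_mono) auto
  obtain y where y: "0 < y" "y < 1" "\<forall>\<^sub>F x in at_top. G (x * y) \<le> 2 * G x"
    using consistently_varying_tailD[OF assms(9), of 1] unfolding cdf_G by auto
  define T where "T x = prob {\<omega> \<in> space M. (\<Sum>i=1..N \<omega>. X i \<omega>) > x}" for x
  have small: "(\<lambda>x. x * prob {\<omega> \<in> space M. X 1 \<omega> > x}) \<in> o[at_top](G)"
    using assms(12) unfolding G_def .
  have \<mu>: "expectation (X 1) = \<mu>" using assms(7) by simp
  note upper = deviations_negligible(1)[OF G_anti G_pos y small, unfolded \<mu>]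
  note lower = deviations_negligible(2)[OF G_anti G_pos y small, unfolded \<mu>]
  have lim: "filterlim (\<lambda>x. x * b) at_top at_top" if "b > 0" for b :: real
    using that by real_asymp
  have lim_\<mu>: "filterlim (\<lambda>x. x / \<mu>) at_top at_top"
    using \<open>\<mu> > 0\<close> by real_asymp
  \<comment> \<open>Transfers negligibility from integers \<open>n\<close> to a continuous
    \<open>x\<close> along the index \<open>\<lfloor>b * x\<rfloor>\<close>.\<close>
  have negligible: "(\<lambda>x. u (nat \<lfloor>b * x\<rfloor>)) \<in> o[at_top](\<lambda>x. G (x / \<mu>))"
    if u: "u \<in> o(\<lambda>n. G (real n))" and b: "b > 0" for u :: "nat \<Rightarrow> real" and b
  proof -
    have limb: "filterlim (\<lambda>x. nat \<lfloor>b * x\<rfloor>) sequentially at_top"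
      using b by real_asymp
    have "(\<lambda>x. u (nat \<lfloor>b * x\<rfloor>)) \<in> o[at_top](\<lambda>x. G (real (nat \<lfloor>b * x\<rfloor>)))"
      by (rule landau_o.small.compose[OF u limb])
    also have "(\<lambda>x. G (real (nat \<lfloor>b * x\<rfloor>))) \<in> O[at_top](\<lambda>x. G (x / \<mu>))"
    proof -
      \<comment> \<open>Once \<open>b * x \<ge> 2\<close>, rounding down loses at most half, and
        \<open>b * x / 2\<close> is \<open>b * \<mu> / 2\<close> times
        \<open>x / \<mu>\<close>.\<close>
      obtain C where C: "C > 0" "\<forall>\<^sub>F x in at_top. G (b * \<mu> / 2 * x) \<le> C * G x"
        using tail_dominated[OF G_anti y, of "b * \<mu> / 2"] b \<open>\<mu> > 0\<close> by auto
      have "\<forall>\<^sub>F x in at_top. norm (G (real (nat \<lfloor>b * x\<rfloor>))) \<le> C * norm (G (x / \<mu>))"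
        using eventually_compose_filterlim[OF C(2) lim_\<mu>] eventually_ge_at_top[of "2 / b"]
      proof eventually_elim
        case (elim x)
        have "b * x \<ge> 2" using elim b by (simp add: field_simps)
        then have "real (nat \<lfloor>b * x\<rfloor>) \<ge> b * x / 2" by linarith
        then have "G (real (nat \<lfloor>b * x\<rfloor>)) \<le> G (b * x / 2)"
          by (rule antimonoD[OF G_anti])
        with elim \<open>\<mu> > 0\<close> show ?case
          using G_pos[THEN less_imp_le] by (simp add: mult_ac)
      qed
      then show ?thesis by (rule bigoI)
    qed
    finally show ?thesis .
  qed
  have "(\<lambda>x. T x - G (x / \<mu>)) \<in> o[at_top](\<lambda>x. G (x / \<mu>))"
  proof (rule landau_o.smallI)
    fix e :: real assume e: "e > 0"
    \<comment> \<open>A new \<open>y\<close> depending on \<open>e\<close>; the earlier one served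
      only the growth bounds on \<open>G\<close>.\<close>
    obtain y where y: "0 < y" "y < 1" and ratio: "\<forall>\<^sub>F x in at_top. G (x * y) \<le> (1 + e / 2) * G x"
      using consistently_varying_tailD[OF assms(9), of "e / 2"] e unfolding cdf_G by auto
    \<comment> \<open>Here \<open>\<mu> + \<delta>1 = \<mu> / y\<close>, with no slack because
      rounding down \<open>n1\<close> helps. In contrast
      \<open>\<mu> - \<delta>2 = \<mu> * (1 + y) / 2\<close> lies midway between
      \<open>y * \<mu>\<close> and \<open>\<mu>\<close>, leaving room for the rounding of
      \<open>n2\<close>.\<close>
    define \<delta>1 where "\<delta>1 = \<mu> * (1 / y - 1)"
    define \<delta>2 where "\<delta>2 = \<mu> * (1 - y) / 2"
    have \<delta>: "\<delta>1 > 0" "\<delta>2 > 0"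
      using y \<open>\<mu> > 0\<close> by (auto simp: \<delta>1_def \<delta>2_def)
    define U where "U n = prob {\<omega> \<in> space M. (\<Sum>i=1..n. X i \<omega>) \<ge> real n * (\<mu> + \<delta>1)}" for n
    define L where "L n = prob {\<omega> \<in> space M. (\<Sum>i=1..n. X i \<omega>) \<le> real n * (\<mu> - \<delta>2)}" for n
    define n1 where "n1 x = nat \<lfloor>y / \<mu> * x\<rfloor>" for x
    define n2 where "n2 x = nat \<lfloor>1 / (y * \<mu>) * x\<rfloor>" for x
    have U: "\<forall>\<^sub>F x in at_top. norm (U (n1 x)) \<le> e / 2 * norm (G (x / \<mu>))"
      unfolding n1_def U_def using \<delta> e y \<open>\<mu> > 0\<close>
      by (intro landau_o.smallD[OF negligible] upper) auto
    have L: "\<forall>\<^sub>F x in at_top. norm (L (n2 x)) \<le> e / 2 * norm (G (x / \<mu>))"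
      unfolding n2_def L_def using \<delta> e y \<open>\<mu> > 0\<close>
      by (intro landau_o.smallD[OF negligible] lower) auto
    have r1: "\<forall>\<^sub>F x in at_top. G (y / \<mu> * x) \<le> (1 + e / 2) * G (x / \<mu>)"
      using eventually_compose_filterlim[OF ratio lim_\<mu>] by (simp add: mult_ac)
    have r2: "\<forall>\<^sub>F x in at_top. G (x / \<mu>) \<le> (1 + e / 2) * G (1 / (y * \<mu>) * x)"
      using eventually_compose_filterlim[OF ratio lim[of "1 / (y * \<mu>)"]] \<open>\<mu> > 0\<close> y by (simp add: mult_ac)
    \<comment> \<open>The first threshold on \<open>x\<close> says
      \<open>w * (1 - y) \<ge> 1 + y\<close> for \<open>w = x / (y * \<mu>)\<close>, equivalently
      \<open>w * y \<le> (w - 1) * (1 + y) / 2\<close>: the slack in \<open>\<delta>2\<close> then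
      covers the loss of 1 in the floor.\<close>
    show "\<forall>\<^sub>F x in at_top. norm (T x - G (x / \<mu>)) \<le> e * norm (G (x / \<mu>))"
      using U L r1 r2 eventually_ge_at_top[of "y * \<mu> * (1 + 2 * y / (1 - y))"] eventually_gt_at_top[of 0]
    proof eventually_elim
      case (elim x)
      note G0 = G_pos[of "x / \<mu>"]
      have le: "T x \<le> (1 + e) * G (x / \<mu>)"
      proof -
        have "real (n1 x) \<le> y / \<mu> * x"
          unfolding n1_def using elim y \<open>\<mu> > 0\<close> by (intro of_nat_floor) simp
        then have "real (n1 x) * (\<mu> + \<delta>1) \<le> x"
          using y \<open>\<mu> > 0\<close> by (simp add: \<delta>1_def field_simps)
        then have "prob {\<omega> \<in> space M. (\<Sum>i=1..n1 x. X i \<omega>) \<ge> x} \<le> U (n1 x)"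
          unfolding U_def using measurable_partial_sum
          by (intro finite_measure_mono) auto
        then have "T x \<le> G (y / \<mu> * x) + U (n1 x)"
          using random_sum_tail_le[OF assms(2) n1_def[of x], of x] unfolding T_def G_def by linarith
        also have "\<dots> \<le> (1 + e / 2) * G (x / \<mu>) + e / 2 * G (x / \<mu>)"
          using elim G0 by (intro add_mono) auto
        finally show ?thesis by (simp add: algebra_simps)
      qed
      have ge: "(1 - e) * G (x / \<mu>) \<le> T x"
      proof -
        define w where "w = 1 / (y * \<mu>) * x"
        have w: "x = w * y * \<mu>" "w \<ge> 1 + 2 * y / (1 - y)"
          using elim y \<open>\<mu> > 0\<close> by (simp_all add: w_def field_simps)
        have n2: "real (n2 x) \<ge> w - 1" unfolding n2_def w_def by linarith
        have "w * y \<le> (w - 1) * (1 + y) / 2"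
        proof -
          have "(1 + 2 * y / (1 - y)) * (1 - y) \<le> w * (1 - y)"
            using w(2) y by (intro mult_right_mono) auto
          also have "(1 + 2 * y / (1 - y)) * (1 - y) = 1 + y"
            using y by (simp add: field_simps)
          finally show ?thesis by (simp add: algebra_simps)
        qed
        also have "\<dots> \<le> real (n2 x) * (1 + y) / 2"
          using n2 y by (intro divide_right_mono mult_right_mono) auto
        finally have "w * y * \<mu> \<le> real (n2 x) * (1 + y) / 2 * \<mu>"
          using \<open>\<mu> > 0\<close> by (intro mult_right_mono) auto
        then have "x \<le> real (n2 x) * (\<mu> - \<delta>2)"
          by (simp add: w(1) \<delta>2_def field_simps)
        then have "prob {\<omega> \<in> space M. (\<Sum>i=1..n2 x. X i \<omega>) \<le> x} \<le> L (n2 x)"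
          unfolding L_def using measurable_partial_sum
          by (intro finite_measure_mono) auto
        then have "G w \<le> T x + L (n2 x)"
          using random_sum_tail_ge[OF assms(2) n2_def[of x], of x] unfolding T_def G_def w_def by linarith
        then have "G w \<le> T x + e / 2 * G (x / \<mu>)"
          using elim G0 by auto
        \<comment> \<open>Inverts the factor \<open>1 + e / 2\<close> via
          \<open>(1 - e / 2) * (1 + e / 2) \<le> 1\<close>; multiplying by \<open>1 - e / 2\<close>
          needs \<open>e \<le> 2\<close>, and otherwise the left side is negative.\<close>
        moreover have "(1 - e / 2) * G (x / \<mu>) \<le> G w"
        proof (cases "e \<le> 2")
          case True
          then have "(1 - e / 2) * G (x / \<mu>) \<le> (1 - e / 2) * ((1 + e / 2) * G w)"
            using elim unfolding w_def by (intro mult_left_mono) auto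
          also have "\<dots> = G w - (e / 2)\<^sup>2 * G w"
            by (simp add: field_simps power2_eq_square)
          also have "\<dots> \<le> G w" using G_pos[of w] by simp
          finally show ?thesis .
        next
          case False
          then have "(1 - e / 2) * G (x / \<mu>) \<le> 0" using G0 by (simp add: mult_nonpos_nonneg)
          then show ?thesis using G_pos[of w] by linarith
        qed
        ultimately show ?thesis by (simp add: algebra_simps)
      qed
      show ?case using le ge G0 by (simp add: abs_le_iff algebra_simps)
    qed
  qed
  then show ?thesis
    unfolding T_def G_def by (simp add: asymp_equiv_altdef)
qed

end
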